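(* Let $(M,g)$ be the interior black hole (IBH) spacetime with metric $$g=-\Big(\tfrac{2\xi}{t}-1\Big)^{-1}dt^2+\Big(\tfrac{2\xi}{t}-1\Big)dz^2+t^2\big(d\theta^2+\sin^2\theta\, d\phi^2\big),$$ where $\xi=\xi(t)$ is a smooth function, and let $X=\big(1-\frac{2\xi}{t}\big)\frac{\partial}{\partial t}$, a non-Killing vector field. Then, with respect to $X$ as soliton vector field, $(M,g)$ does not admit any of the following structures: (i) Ricci soliton; Yamabe soliton; (ii) gradient Ricci soliton; generalized Ricci soliton; (iii) $\eta$-Ricci soliton; $\eta$-Yamabe soliton.
   Context: Coordinates are $(t,z,\theta,\phi)$ with $t>0$ in an open interval, $0<\theta<\pi$, and $t\neq 2\xi(t)$; dots denote $d/dt$. $\mathcal L_X$ is the Lie derivative. The Ricci tensor $S$ is taken with the sign convention for which $S_{11}=-\frac{\ddot\xi}{t}g_{11}$, $S_{22}=-\frac{\ddot\xi}{t}g_{22}$, $S_{33}=-\frac{2\dot\xi}{t^2}g_{33}$, $S_{44}=-\frac{2\dot\xi}{t^2}g_{44}$ (other components zero), i.e. the negative of the Ricci tensor that is positive on round spheres; the scalar curvature is $\kappa=g^{ij}S_{ij}=-\frac{2(2\dot\xi+t\ddot\xi)}{t^2}$. With respect to a vector field $X$, $(M,g)$ is: - a Ricci soliton if $\frac12\mathcal L_Xg+S-\phi_1g=0$ for some constant $\phi_1$; - a Yamabe soliton if $\frac12\mathcal L_Xg+(\phi_1-\kappa)g=0$ for some constant $\phi_1$; - a gradient Ricci soliton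 if it is a Ricci soliton with respect to $X$ and $X$ is the gradient of a smooth function; - a generalized Ricci soliton if $\mathcal L_Xg=-2c_1X^\flat\otimes X^\flat+2c_2S+2\lambda g$ for some constants $c_1,c_2,\lambda$, where $X^\flat=g(X,\cdot)$; - an $\eta$-Ricci soliton if $\frac12\mathcal L_Xg+S-\phi_1g+\phi_2\,\eta\otimes\eta=0$ for some constants $\phi_1,\phi_2$ and some non-zero (real) $1$-form $\eta$; - an $\eta$-Yamabe soliton if $\frac12\mathcal L_Xg+(\phi_1-\kappa)g+\phi_2\,\eta\otimes\eta=0$ for some constants $\phi_1,\phi_2$ and some non-zero (real) $1$-form $\eta$. *)

theory Defs
  imports "HOL-Analysis.Analysis"
begin

(* Everything is expressed in one coordinate chart: points are x :: real^'n, and scalar functions,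
   vector fields, covector fields and (0,2)-tensor fields are given by their components
   with respect to the coordinate (co)frame. *)

section \<open>Smoothness on open sets\<close>

primrec Ck_on :: "nat \<Rightarrow> 'a::euclidean_space set \<Rightarrow> ('a \<Rightarrow> real) \<Rightarrow> bool" where
  "Ck_on 0 U f \<longleftrightarrow> continuous_on U f"
| "Ck_on (Suc k) U f \<longleftrightarrow>
     f differentiable_on U \<and> (\<forall>b\<in>Basis. Ck_on k U (\<lambda>x. frechet_derivative f (at x) b))"

(* Meant for open U only: the derivatives are taken with respect to the full neighbourhood filter. *)
definition smooth_on :: "'a::euclidean_space set \<Rightarrow> ('a \<Rightarrow> real) \<Rightarrow> bool" where
  "smooth_on U f \<longleftrightarrow> (\<forall>k. Ck_on k U f)"

section \<open>Tensor calculus in coordinates\<close>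

definition pd :: "'n::finite \<Rightarrow> (real^'n \<Rightarrow> real) \<Rightarrow> real^'n \<Rightarrow> real" where
  "pd i f x = frechet_derivative f (at x) (axis i 1)"

(* (L_X g)_ij = X^k d_k g_ij + g_kj d_i X^k + g_ik d_j X^k *)
definition lie_derivative ::
  "(real^'n \<Rightarrow> real^'n) \<Rightarrow> (real^'n \<Rightarrow> real^'n^'n) \<Rightarrow> real^'n \<Rightarrow> real^'n^'n::finite" where
  "lie_derivative X g x = (\<chi> i j.
     (\<Sum>k\<in>UNIV. X x $ k * pd k (\<lambda>y. g y $ i $ j) x
             + g x $ k $ j * pd i (\<lambda>y. X y $ k) x
             + g x $ i $ k * pd j (\<lambda>y. X y $ k) x))"

definition christoffel ::
  "(real^'n \<Rightarrow> real^'n^'n) \<Rightarrow> 'n::finite \<Rightarrow> 'n \<Rightarrow> 'n \<Rightarrow> real^'n \<Rightarrow> real" where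
  "christoffel g k i j x = 1/2 * (\<Sum>l\<in>UNIV. matrix_inv (g x) $ k $ l *
     (pd i (\<lambda>y. g y $ j $ l) x + pd j (\<lambda>y. g y $ i $ l) x - pd l (\<lambda>y. g y $ i $ j) x))"

(* The usual Ricci tensor, positive on round spheres:
   R_ij = d_k Gamma^k_ij - d_j Gamma^k_ik + Gamma^k_kl Gamma^l_ij - Gamma^k_jl Gamma^l_ik *)
definition ricci :: "(real^'n \<Rightarrow> real^'n^'n) \<Rightarrow> real^'n \<Rightarrow> real^'n^'n::finite" where
  "ricci g x = (\<chi> i j.
     (\<Sum>k\<in>UNIV. pd k (christoffel g k i j) x - pd j (christoffel g k i k) x)
   + (\<Sum>k\<in>UNIV. \<Sum>l\<in>UNIV. christoffel g k k l x * christoffel g l i j x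
                       - christoffel g k j l x * christoffel g l i k x))"

(* The opposite sign convention, used in all soliton equations below. *)
definition S_tensor :: "(real^'n \<Rightarrow> real^'n^'n) \<Rightarrow> real^'n \<Rightarrow> real^'n^'n::finite" where
  "S_tensor g x = - ricci g x"

definition scalar_curv :: "(real^'n \<Rightarrow> real^'n^'n) \<Rightarrow> real^'n::finite \<Rightarrow> real" where
  "scalar_curv g x = (\<Sum>i\<in>UNIV. \<Sum>j\<in>UNIV. matrix_inv (g x) $ i $ j * S_tensor g x $ i $ j)"

definition flat :: "(real^'n \<Rightarrow> real^'n^'n) \<Rightarrow> (real^'n \<Rightarrow> real^'n) \<Rightarrow> real^'n \<Rightarrow> real^'n::finite" where
  "flat g X x = X x v* g x"

definition gradient :: "(real^'n \<Rightarrow> real^'n^'n) \<Rightarrow> (real^'n \<Rightarrow> real) \<Rightarrow> real^'n \<Rightarrow> real^'n::finite" where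
  "gradient g u x = matrix_inv (g x) *v (\<chi> j. pd j u x)"

definition tensor_sq :: "real^'n \<Rightarrow> real^'n^'n::finite" where
  "tensor_sq \<alpha> = (\<chi> i j. \<alpha> $ i * \<alpha> $ j)"

definition one_form_on :: "(real^'n) set \<Rightarrow> (real^'n \<Rightarrow> real^'n::finite) \<Rightarrow> bool" where
  "one_form_on M \<eta> \<longleftrightarrow> (\<forall>i. smooth_on M (\<lambda>x. \<eta> x $ i))"

definition killing ::
  "(real^'n) set \<Rightarrow> (real^'n \<Rightarrow> real^'n^'n) \<Rightarrow> (real^'n \<Rightarrow> real^'n::finite) \<Rightarrow> bool" where
  "killing M g X \<longleftrightarrow> (\<forall>x\<in>M. lie_derivative X g x = 0)"

section \<open>Solitons\<close>

definition ricci_soliton ::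
  "(real^'n) set \<Rightarrow> (real^'n \<Rightarrow> real^'n^'n) \<Rightarrow> (real^'n \<Rightarrow> real^'n::finite) \<Rightarrow> bool" where
  "ricci_soliton M g X \<longleftrightarrow> (\<exists>\<phi>\<^sub>1::real. \<forall>x\<in>M.
     (1/2) *\<^sub>R lie_derivative X g x + S_tensor g x - \<phi>\<^sub>1 *\<^sub>R g x = 0)"

definition yamabe_soliton ::
  "(real^'n) set \<Rightarrow> (real^'n \<Rightarrow> real^'n^'n) \<Rightarrow> (real^'n \<Rightarrow> real^'n::finite) \<Rightarrow> bool" where
  "yamabe_soliton M g X \<longleftrightarrow> (\<exists>\<phi>\<^sub>1::real. \<forall>x\<in>M.
     (1/2) *\<^sub>R lie_derivative X g x + (\<phi>\<^sub>1 - scalar_curv g x) *\<^sub>R g x = 0)"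

definition gradient_ricci_soliton ::
  "(real^'n) set \<Rightarrow> (real^'n \<Rightarrow> real^'n^'n) \<Rightarrow> (real^'n \<Rightarrow> real^'n::finite) \<Rightarrow> bool" where
  "gradient_ricci_soliton M g X \<longleftrightarrow> ricci_soliton M g X \<and>
     (\<exists>u. smooth_on M u \<and> (\<forall>x\<in>M. X x = gradient g u x))"

definition generalized_ricci_soliton ::
  "(real^'n) set \<Rightarrow> (real^'n \<Rightarrow> real^'n^'n) \<Rightarrow> (real^'n \<Rightarrow> real^'n::finite) \<Rightarrow> bool" where
  "generalized_ricci_soliton M g X \<longleftrightarrow> (\<exists>c\<^sub>1 c\<^sub>2 l::real. \<forall>x\<in>M.
     lie_derivative X g x =
       (- 2 * c\<^sub>1) *\<^sub>R tensor_sq (flat g X x) + (2 * c\<^sub>2) *\<^sub>R S_tensor g x + (2 * l) *\<^sub>R g x)"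

(* In the two eta-structures "non-zero" means not identically zero on M. *)

definition eta_ricci_soliton ::
  "(real^'n) set \<Rightarrow> (real^'n \<Rightarrow> real^'n^'n) \<Rightarrow> (real^'n \<Rightarrow> real^'n::finite) \<Rightarrow> bool" where
  "eta_ricci_soliton M g X \<longleftrightarrow> (\<exists>(\<phi>\<^sub>1::real) (\<phi>\<^sub>2::real) \<eta>.
     one_form_on M \<eta> \<and> (\<exists>x\<in>M. \<eta> x \<noteq> 0) \<and>
     (\<forall>x\<in>M. (1/2) *\<^sub>R lie_derivative X g x + S_tensor g x - \<phi>\<^sub>1 *\<^sub>R g x
             + \<phi>\<^sub>2 *\<^sub>R tensor_sq (\<eta> x) = 0))"

definition eta_yamabe_soliton ::
  "(real^'n) set \<Rightarrow> (real^'n \<Rightarrow> real^'n^'n) \<Rightarrow> (real^'n \<Rightarrow> real^'n::finite) \<Rightarrow> bool" where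
  "eta_yamabe_soliton M g X \<longleftrightarrow> (\<exists>(\<phi>\<^sub>1::real) (\<phi>\<^sub>2::real) \<eta>.
     one_form_on M \<eta> \<and> (\<exists>x\<in>M. \<eta> x \<noteq> 0) \<and>
     (\<forall>x\<in>M. (1/2) *\<^sub>R lie_derivative X g x + (\<phi>\<^sub>1 - scalar_curv g x) *\<^sub>R g x
             + \<phi>\<^sub>2 *\<^sub>R tensor_sq (\<eta> x) = 0))"

section \<open>The interior black hole spacetime\<close>

(* x$1 = t, x$2 = z, x$3 = theta, x$4 = phi.  The coordinate phi is not restricted to one period:
   objects on the spacetime pull back to this domain (they become 2 pi-periodic in phi), but the
   functions and 1-forms considered on it are not required to be periodic. *)
definition ibh_domain :: "real set \<Rightarrow> (real^4) set" where
  "ibh_domain I = {x. x $ 1 \<in> I \<and> 0 < x $ 3 \<and> x $ 3 < pi}"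

definition ibh_metric :: "(real \<Rightarrow> real) \<Rightarrow> real^4 \<Rightarrow> real^4^4" where
  "ibh_metric \<xi> x = (\<chi> i j.
     if i \<noteq> j then 0
     else if i = 1 then - inverse (2 * \<xi> (x $ 1) / x $ 1 - 1)
     else if i = 2 then 2 * \<xi> (x $ 1) / x $ 1 - 1
     else if i = 3 then (x $ 1)\<^sup>2
     else (x $ 1)\<^sup>2 * (sin (x $ 3))\<^sup>2)"

definition ibh_field :: "(real \<Rightarrow> real) \<Rightarrow> real^4 \<Rightarrow> real^4" where
  "ibh_field \<xi> x = (1 - 2 * \<xi> (x $ 1) / x $ 1) *\<^sub>R axis 1 1"

end

theory Submission
  imports Defs
begin

text \<open>Write \<open>F = 2 \<xi> / t - 1\<close>. The metric, the Lie derivative of the metric along \<open>X\<close> and the Ricci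
  tensor are all diagonal and act by one scalar on the \<open>(t, z)\<close> block and by another one on the
  sphere block, so a soliton equation amounts to two ordinary differential equations. A rank-one
  term \<open>\<eta> \<otimes> \<eta>\<close> can cancel neither block, hence the \<open>\<eta>\<close>-solitons reduce to the plain ones, and
  so does the generalized soliton, whose extra term \<open>X\<^sup>\<flat> \<otimes> X\<^sup>\<flat>\<close> is of the same kind. Differentiating
  the sphere equation and comparing it with the \<open>(t, z)\<close> equation forces \<open>F = 0\<close>; in the Yamabe
  case one first gets \<open>t F' = 2 F\<close> and then \<open>t F = - 4\<close>, which again forces \<open>F = 0\<close>.\<close>

section \<open>Preliminaries: inverses of diagonal matrices and derivatives of functions of one
  variable\<close>

lemma matrix_inv_unique:
  fixes A :: "'a::semiring_1^'n::finite^'n"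
  assumes "A ** B = mat 1" "B ** A = mat 1"
  shows "matrix_inv A = B"
  unfolding matrix_inv_def
proof (rule some_equality)
  show "A ** B = mat 1 \<and> B ** A = mat 1"
    using assms by simp
  fix C assume C: "A ** C = mat 1 \<and> C ** A = mat 1"
  then have "C = (B ** A) ** C"
    using assms by simp
  also have "\<dots> = B"
    using C by (simp flip: matrix_mul_assoc)
  finally show "C = B" .
qed

lemma matrix_inv_diagonal:
  fixes A :: "real^'n^'n::finite"
  assumes off: "\<And>i j. i \<noteq> j \<Longrightarrow> A $ i $ j = 0" and diag: "\<And>i. A $ i $ i \<noteq> 0"
  shows "matrix_inv A = (\<chi> i j. if i = j then inverse (A $ i $ i) else 0)" (is "_ = ?B")
proof (rule matrix_inv_unique)
  have "(\<Sum>k\<in>UNIV. A $ i $ k * ?B $ k $ j) = (if i = j then 1 else 0)" for i j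
    using off[of i j] diag by (simp add: if_distrib[of "\<lambda>a. _ * a"] cong: if_cong)
  then show "A ** ?B = mat 1"
    by (simp add: matrix_matrix_mult_def mat_def vec_eq_iff)
  have "(\<Sum>k\<in>UNIV. ?B $ i $ k * A $ k $ j) = (if i = j then 1 else 0)" for i j
    using off[of i j] diag by (simp add: if_distrib[of "\<lambda>a. a * _"] cong: if_cong)
  then show "?B ** A = mat 1"
    by (simp add: matrix_matrix_mult_def mat_def vec_eq_iff)
qed

text \<open>The Ricci tensor involves at most second derivatives of the metric, so level two of
  \<open>Ck_on\<close> is enough. The witnesses are the Frechet derivatives applied to 1, the only
  basis vector of the line.\<close>

lemma smooth_on_imp_two_derivatives:
  fixes f :: "real \<Rightarrow> real"
  assumes "open I" "smooth_on I f"
  obtains f' f'' where "\<And>t. t \<in> I \<Longrightarrow> (f has_real_derivative f' t) (at t)"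
    and "\<And>t. t \<in> I \<Longrightarrow> (f' has_real_derivative f'' t) (at t)"
proof -
  have *: "(h has_real_derivative frechet_derivative h (at t) 1) (at t)"
    if "h differentiable_on I" "t \<in> I" for h :: "real \<Rightarrow> real" and t
  proof -
    have "h differentiable at t"
      using that \<open>open I\<close> by (simp add: differentiable_on_eq_differentiable_at)
    then obtain D where D: "(h has_real_derivative D) (at t)"
      using real_differentiable_def by blast
    then have "frechet_derivative h (at t) = (*) D"
      unfolding has_field_derivative_def by (rule frechet_derivative_at[symmetric])
    with D show ?thesis by simp
  qed
  have "Ck_on (Suc (Suc 0)) I f"
    using assms(2) unfolding smooth_on_def by blast
  then have "f differentiable_on I" "(\<lambda>x. frechet_derivative f (at x) 1) differentiable_on I"
    by simp_all
  then show thesis by (intro that[OF * *])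
qed

section \<open>The curvature of the metric\<close>

text \<open>A derivative depends only on germs. This is needed because the closed forms of the
  Christoffel symbols hold only on the chart domain, yet have to be differentiated.\<close>

lemma pd_cong:
  assumes "open S" "x \<in> S" "\<And>y. y \<in> S \<Longrightarrow> f y = h y"
  shows "pd i f x = pd i h x"
proof -
  have "(f has_derivative D) (at x) \<longleftrightarrow> (h has_derivative D) (at x)" for D
    using assms has_derivative_transform_within_open[of f D x UNIV S h]
      has_derivative_transform_within_open[of h D x UNIV S f] by auto
  then show ?thesis by (simp add: pd_def frechet_derivative_def)
qed

text \<open>Each metric component and each Christoffel symbol is a function of t times a function of
  theta, so this single product rule covers all partial derivatives below.\<close>

lemma pd_separated:
  fixes x :: "real^4"
  assumes p: "(p has_real_derivative p') (at (x $ 1))"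
    and q: "(q has_real_derivative q') (at (x $ 3))"
  shows "pd i (\<lambda>y. p (y $ 1) * q (y $ 3)) x =
    (if i = 1 then p' * q (x $ 3) else if i = 3 then p (x $ 1) * q' else 0)"
proof -
  have n: "((\<lambda>y::real^4. y $ k) has_derivative (\<lambda>v. v $ k)) (at x)" for k
    by (rule bounded_linear_imp_has_derivative) (rule bounded_linear_vec_nth)
  have P: "((\<lambda>y. p (y $ 1)) has_derivative (\<lambda>v. p' * v $ 1)) (at x)"
    using has_derivative_compose[OF n p[unfolded has_field_derivative_def]] by simp
  have Q: "((\<lambda>y. q (y $ 3)) has_derivative (\<lambda>v. q' * v $ 3)) (at x)"
    using has_derivative_compose[OF n q[unfolded has_field_derivative_def]] by simp
  have "frechet_derivative (\<lambda>y. p (y $ 1) * q (y $ 3)) (at x) =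
      (\<lambda>v. p (x $ 1) * (q' * v $ 3) + p' * v $ 1 * q (x $ 3))"
    by (rule frechet_derivative_at[OF has_derivative_mult[OF P Q], symmetric])
  then show ?thesis by (auto simp: pd_def axis_def)
qed

lemma pd_const [simp]: "pd i (\<lambda>y. c) x = 0"
  by (simp add: pd_def)

lemma pd_fun_first:
  fixes x :: "real^4"
  assumes "(p has_real_derivative p') (at (x $ 1))"
  shows "pd i (\<lambda>y. p (y $ 1)) x = (if i = 1 then p' else 0)"
  using pd_separated[OF assms, of "\<lambda>_. 1" 0 i] by simp

lemma pd_fun_third:
  fixes x :: "real^4"
  assumes "(q has_real_derivative q') (at (x $ 3))"
  shows "pd i (\<lambda>y. q (y $ 3)) x = (if i = 3 then q' else 0)"
  using pd_separated[OF _ assms, of "\<lambda>_. 1" 0 i] by simp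

text \<open>\<open>F_eq\<close> is imposed at every real t, so the metric and the field can be
  rewritten through \<open>F\<close> under \<open>pd\<close>. The other conditions on
  \<open>F\<close> and its derivatives are local to \<open>I\<close>.\<close>

locale ibh_chart =
  fixes \<xi> F F' F'' :: "real \<Rightarrow> real" and I :: "real set"
  assumes open_I: "open I" and pos: "t \<in> I \<Longrightarrow> 0 < t"
    and F_eq: "F t = 2 * \<xi> t / t - 1" and F_nz: "t \<in> I \<Longrightarrow> F t \<noteq> 0"
    and F_deriv: "t \<in> I \<Longrightarrow> (F has_real_derivative F' t) (at t)"
    and F'_deriv: "t \<in> I \<Longrightarrow> (F' has_real_derivative F'' t) (at t)"
begin

abbreviation "M \<equiv> ibh_domain I"
abbreviation "g \<equiv> ibh_metric \<xi>"
abbreviation "X \<equiv> ibh_field \<xi>"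

lemma open_M: "open M"
proof -
  have "M = (\<lambda>x. x $ 1) -` I \<inter> ((\<lambda>x. x $ 3) -` {0<..<pi})"
    by (auto simp: ibh_domain_def)
  also have "open \<dots>"
    by (intro open_Int open_vimage open_I open_greaterThanLessThan continuous_intros)
  finally show ?thesis .
qed

lemma in_M:
  assumes "x \<in> M"
  shows "x $ 1 \<in> I" "0 < x $ 1" "F (x $ 1) \<noteq> 0" "0 < sin (x $ 3)"
  using assms pos F_nz by (auto simp: ibh_domain_def sin_gt_zero)

text \<open>The block factors below depend on t alone, so one point for each t, here on the equator,
  extracts the differential equations.\<close>

lemma point_in_M:
  assumes "t \<in> I"
  obtains x where "x \<in> M" "x $ 1 = t"
proof
  show "vector [t, 0, pi / 2, 0] \<in> M" "(vector [t, 0, pi / 2, 0] :: real^4) $ 1 = t"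
    using assms by (auto simp: ibh_domain_def vector_def)
qed

lemma metric:
  "g x = (\<chi> i j. if i \<noteq> j then 0 else if i = 1 then - inverse (F (x $ 1))
     else if i = 2 then F (x $ 1) else if i = 3 then (x $ 1)\<^sup>2 else (x $ 1)\<^sup>2 * (sin (x $ 3))\<^sup>2)"
  by (simp add: ibh_metric_def F_eq vec_eq_iff)

lemma field: "X x $ k = (if k = 1 then - F (x $ 1) else 0)"
  by (simp add: ibh_field_def F_eq axis_def)

lemma matrix_inv_metric:
  assumes "x \<in> M"
  shows "matrix_inv (g x) = (\<chi> i j. if i = j then inverse (g x $ i $ i) else 0)"
  using in_M[OF assms] by (intro matrix_inv_diagonal) (auto simp: metric)

lemma pd_metric:
  assumes "x \<in> M"
  shows "pd m (\<lambda>y. g y $ i $ j) x =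
    (if i \<noteq> j then 0
     else if i = 1 then (if m = 1 then F' (x $ 1) / (F (x $ 1))\<^sup>2 else 0)
     else if i = 2 then (if m = 1 then F' (x $ 1) else 0)
     else if i = 3 then (if m = 1 then 2 * x $ 1 else 0)
     else (if m = 1 then 2 * x $ 1 * (sin (x $ 3))\<^sup>2
           else if m = 3 then 2 * (x $ 1)\<^sup>2 * sin (x $ 3) * cos (x $ 3) else 0))"
proof -
  note [derivative_intros] = F_deriv[OF in_M(1)[OF assms]]
  note nz = in_M[OF assms]
  have 1: "((\<lambda>t. - inverse (F t)) has_real_derivative F' (x $ 1) / (F (x $ 1))\<^sup>2) (at (x $ 1))"
    by (rule derivative_eq_intros refl nz)+ (simp add: power2_eq_square field_simps nz)
  have 2: "((\<lambda>t. t\<^sup>2) has_real_derivative 2 * x $ 1) (at (x $ 1))"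
    by (auto intro!: derivative_eq_intros)
  have 3: "((\<lambda>t. (sin t)\<^sup>2) has_real_derivative 2 * sin (x $ 3) * cos (x $ 3)) (at (x $ 3))"
    by (auto intro!: derivative_eq_intros)
  show ?thesis
    using exhaust_4[of i]
    by (auto simp: metric pd_fun_first[OF 1] pd_fun_first[OF 2] pd_separated[OF 2 3]
        pd_fun_first[OF F_deriv[OF nz(1)]])
qed

text \<open>Closed forms of the Christoffel symbols with upper index \<open>k\<close>. The
  abstraction over \<open>y\<close> stands outermost, so that for numeric indices unfolding leaves
  the functions differentiated in \<open>pd_Gam\<close>.\<close>

definition Gam :: "4 \<Rightarrow> 4 \<Rightarrow> 4 \<Rightarrow> real^4 \<Rightarrow> real" where
  "Gam k i j = (\<lambda>y.
    (if k = 1 then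
       (if i \<noteq> j then 0
        else if i = 1 then - (F' (y $ 1) / (2 * F (y $ 1)))
        else if i = 2 then F (y $ 1) * F' (y $ 1) / 2
        else if i = 3 then y $ 1 * F (y $ 1)
        else y $ 1 * F (y $ 1) * (sin (y $ 3))\<^sup>2)
     else if k = 2 then
       (if (i, j) \<in> {(1, 2), (2, 1)} then F' (y $ 1) / (2 * F (y $ 1)) else 0)
     else if k = 3 then
       (if (i, j) \<in> {(1, 3), (3, 1)} then inverse (y $ 1)
        else if (i, j) = (4, 4) then - (sin (y $ 3) * cos (y $ 3)) else 0)
     else
       (if (i, j) \<in> {(1, 4), (4, 1)} then inverse (y $ 1)
        else if (i, j) \<in> {(3, 4), (4, 3)} then cos (y $ 3) / sin (y $ 3) else 0)))"

lemma christoffel_ibh: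
  assumes "x \<in> M"
  shows "christoffel g k i j x = Gam k i j x"
proof -
  \<comment> \<open>The inverse metric is diagonal, so only l = k survives in the sum.\<close>
  have *: "christoffel g k i j x = 1/2 * inverse (g x $ k $ k) *
     (pd i (\<lambda>y. g y $ j $ k) x + pd j (\<lambda>y. g y $ i $ k) x - pd k (\<lambda>y. g y $ i $ j) x)"
    unfolding christoffel_def matrix_inv_metric[OF assms]
    by (simp add: if_distrib[of "\<lambda>a. a * _"] cong: if_cong)
  show ?thesis
    using exhaust_4[of k] exhaust_4[of i] exhaust_4[of j] in_M[OF assms]
    unfolding * pd_metric[OF assms] Gam_def
    by (elim disjE) (simp_all add: metric power2_eq_square field_simps)
qed

lemma pd_christoffel:
  assumes "x \<in> M"
  shows "pd m (christoffel g k i j) x = pd m (Gam k i j) x"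
  by (rule pd_cong[OF open_M assms]) (rule christoffel_ibh)

text \<open>The functions on the left are the non-zero entries of \<open>Gam\<close>, written
  exactly as there so that they match as rewrite rules.\<close>

lemma pd_Gam:
  assumes "x \<in> M"
  shows "pd m (\<lambda>y. - (F' (y $ 1) / (2 * F (y $ 1)))) x = (if m = 1 then
      - (F'' (x $ 1) / (2 * F (x $ 1)) - (F' (x $ 1))\<^sup>2 / (2 * (F (x $ 1))\<^sup>2)) else 0)"
    and "pd m (\<lambda>y. F' (y $ 1) / (2 * F (y $ 1))) x = (if m = 1 then
      F'' (x $ 1) / (2 * F (x $ 1)) - (F' (x $ 1))\<^sup>2 / (2 * (F (x $ 1))\<^sup>2) else 0)"
    and "pd m (\<lambda>y. F (y $ 1) * F' (y $ 1) / 2) x = (if m = 1 then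
      ((F' (x $ 1))\<^sup>2 + F (x $ 1) * F'' (x $ 1)) / 2 else 0)"
    and "pd m (\<lambda>y. y $ 1 * F (y $ 1)) x = (if m = 1 then F (x $ 1) + x $ 1 * F' (x $ 1) else 0)"
    and "pd m (\<lambda>y. y $ 1 * F (y $ 1) * (sin (y $ 3))\<^sup>2) x =
      (if m = 1 then (F (x $ 1) + x $ 1 * F' (x $ 1)) * (sin (x $ 3))\<^sup>2
       else if m = 3 then x $ 1 * F (x $ 1) * (2 * sin (x $ 3) * cos (x $ 3)) else 0)"
    and "pd m (\<lambda>y. inverse (y $ 1)) x = (if m = 1 then - inverse ((x $ 1)\<^sup>2) else 0)"
    and "pd m (\<lambda>y. - (sin (y $ 3) * cos (y $ 3))) x =
      (if m = 3 then (sin (x $ 3))\<^sup>2 - (cos (x $ 3))\<^sup>2 else 0)"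
    and "pd m (\<lambda>y. cos (y $ 3) / sin (y $ 3)) x =
      (if m = 3 then - 1 - (cos (x $ 3))\<^sup>2 / (sin (x $ 3))\<^sup>2 else 0)"
proof -
  note nz = in_M[OF assms]
  note [derivative_intros] = F_deriv[OF nz(1)] F'_deriv[OF nz(1)]
  have 1: "((\<lambda>t. F' t / (2 * F t)) has_real_derivative
      F'' (x $ 1) / (2 * F (x $ 1)) - (F' (x $ 1))\<^sup>2 / (2 * (F (x $ 1))\<^sup>2)) (at (x $ 1))"
    using nz by (auto intro!: derivative_eq_intros simp: power2_eq_square field_simps)
  have 2: "((\<lambda>t. t * F t) has_real_derivative F (x $ 1) + x $ 1 * F' (x $ 1)) (at (x $ 1))"
    by (auto intro!: derivative_eq_intros)
  have 3: "((\<lambda>t. (sin t)\<^sup>2) has_real_derivative 2 * sin (x $ 3) * cos (x $ 3)) (at (x $ 3))"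
    by (auto intro!: derivative_eq_intros)
  show "pd m (\<lambda>y. - (F' (y $ 1) / (2 * F (y $ 1)))) x = (if m = 1 then
      - (F'' (x $ 1) / (2 * F (x $ 1)) - (F' (x $ 1))\<^sup>2 / (2 * (F (x $ 1))\<^sup>2)) else 0)"
    by (rule pd_fun_first[OF DERIV_minus[OF 1]])
  show "pd m (\<lambda>y. F' (y $ 1) / (2 * F (y $ 1))) x = (if m = 1 then
      F'' (x $ 1) / (2 * F (x $ 1)) - (F' (x $ 1))\<^sup>2 / (2 * (F (x $ 1))\<^sup>2) else 0)"
    by (rule pd_fun_first[OF 1])
  show "pd m (\<lambda>y. F (y $ 1) * F' (y $ 1) / 2) x = (if m = 1 then
      ((F' (x $ 1))\<^sup>2 + F (x $ 1) * F'' (x $ 1)) / 2 else 0)"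
    by (rule pd_fun_first) (auto intro!: derivative_eq_intros simp: power2_eq_square)
  show "pd m (\<lambda>y. y $ 1 * F (y $ 1)) x = (if m = 1 then F (x $ 1) + x $ 1 * F' (x $ 1) else 0)"
    by (rule pd_fun_first[OF 2])
  show "pd m (\<lambda>y. y $ 1 * F (y $ 1) * (sin (y $ 3))\<^sup>2) x =
      (if m = 1 then (F (x $ 1) + x $ 1 * F' (x $ 1)) * (sin (x $ 3))\<^sup>2
       else if m = 3 then x $ 1 * F (x $ 1) * (2 * sin (x $ 3) * cos (x $ 3)) else 0)"
    by (rule pd_separated[OF 2 3])
  show "pd m (\<lambda>y. inverse (y $ 1)) x = (if m = 1 then - inverse ((x $ 1)\<^sup>2) else 0)"
    using nz by (intro pd_fun_first)
      (auto intro!: derivative_eq_intros simp: power2_eq_square field_simps)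
  show "pd m (\<lambda>y. - (sin (y $ 3) * cos (y $ 3))) x =
      (if m = 3 then (sin (x $ 3))\<^sup>2 - (cos (x $ 3))\<^sup>2 else 0)"
    by (rule pd_fun_third) (auto intro!: derivative_eq_intros simp: power2_eq_square)
  show "pd m (\<lambda>y. cos (y $ 3) / sin (y $ 3)) x =
      (if m = 3 then - 1 - (cos (x $ 3))\<^sup>2 / (sin (x $ 3))\<^sup>2 else 0)"
    using nz by (intro pd_fun_third)
      (auto intro!: derivative_eq_intros simp: power2_eq_square field_simps)
qed

text \<open>The eigenvalues of the (round-positive) Ricci tensor on the two blocks, \<open>\<xi>'' / t\<close> and
  \<open>2 \<xi>' / t\<^sup>2\<close> in terms of \<open>\<xi>\<close>.\<close>

definition "ric_tz t = F'' t / 2 + F' t / t"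
definition "ric_sph t = (F t + 1 + t * F' t) / t\<^sup>2"

text \<open>Scaling \<open>g\<close> blockwise, instead of listing diagonal entries, leaves the
  theta dependence inside \<open>g\<close>, so that the factors of all tensors involved are
  functions of t only.\<close>

definition block :: "real \<Rightarrow> real \<Rightarrow> real^4 \<Rightarrow> real^4^4" where
  "block a b x = (\<chi> i j. (if i = 1 \<or> i = 2 then a else b) * g x $ i $ j)"

lemma S_tensor_ibh:
  assumes "x \<in> M"
  shows "S_tensor g x = block (- ric_tz (x $ 1)) (- ric_sph (x $ 1)) x"
proof -
  note nz = in_M[OF assms]
  have "S_tensor g x $ i $ j =
      - (if i = 1 \<or> i = 2 then ric_tz (x $ 1) else ric_sph (x $ 1)) * g x $ i $ j" for i j
  proof -
    have "ricci g x $ i $ j =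
     (\<Sum>k\<in>UNIV. pd k (Gam k i j) x - pd j (Gam k i k) x)
   + (\<Sum>k\<in>UNIV. \<Sum>l\<in>UNIV. Gam k k l x * Gam l i j x - Gam k j l x * Gam l i k x)"
      by (simp add: ricci_def pd_christoffel[OF assms] christoffel_ibh[OF assms])
    also have "\<dots> = (if i = 1 \<or> i = 2 then ric_tz (x $ 1) else ric_sph (x $ 1)) * g x $ i $ j"
      using exhaust_4[of i] exhaust_4[of j] nz sin_cos_squared_add[of "x $ 3"]
      by (elim disjE; simp add: sum_4 Gam_def pd_Gam[OF assms] ric_tz_def ric_sph_def metric;
          (simp add: field_simps power2_eq_square; algebra?)?)
    finally show ?thesis by (simp add: S_tensor_def)
  qed
  then show ?thesis by (simp add: vec_eq_iff block_def)
qed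

text \<open>Each block has dimension two, so its factor is counted twice in the trace.\<close>

lemma scalar_curv_ibh:
  assumes "x \<in> M"
  shows "scalar_curv g x = - 2 * (ric_tz (x $ 1) + ric_sph (x $ 1))"
  using in_M[OF assms]
  unfolding scalar_curv_def matrix_inv_metric[OF assms] S_tensor_ibh[OF assms]
  by (simp add: sum_4 block_def metric field_simps)

text \<open>Here \<open>X\<close> is -F times the t-direction. In the tt entry the derivative of
  -1/F combines with twice the derivative of -F to give F'/F, which is the same multiple -F' of the
  metric as in the zz entry.\<close>

lemma lie_derivative_ibh:
  assumes "x \<in> M"
  shows "lie_derivative X g x = block (- F' (x $ 1)) (- 2 * F (x $ 1) / x $ 1) x"
proof -
  note nz = in_M[OF assms]
  have X: "pd i (\<lambda>y. X y $ k) x = (if k = 1 \<and> i = 1 then - F' (x $ 1) else 0)" for i k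
    using pd_fun_first[OF DERIV_minus[OF F_deriv[OF nz(1)]], of i]
    by (cases "k = 1") (simp_all add: field)
  have "lie_derivative X g x $ i $ j =
      block (- F' (x $ 1)) (- 2 * F (x $ 1) / x $ 1) x $ i $ j" for i j
    using exhaust_4[of i] exhaust_4[of j] nz
    by (elim disjE; simp add: lie_derivative_def sum_4 X pd_metric[OF assms] block_def;
        (simp add: field metric field_simps power2_eq_square)?)
  then show ?thesis by (simp add: vec_eq_iff)
qed

section \<open>Algebra of block tensors and their independence from rank-one terms\<close>

lemma metric_block: "g x = block 1 1 x"
  by (simp add: block_def vec_eq_iff)

lemma block_simps:
  "block a b x + block c d x = block (a + c) (b + d) x"
  "block a b x - block c d x = block (a - c) (b - d) x"
  "r *\<^sub>R block a b x = block (r * a) (r * b) x"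
  by (simp_all add: block_def vec_eq_iff algebra_simps)

text \<open>Each block is diagonal of size two with non-zero entries, so it cannot be cancelled by a
  tensor of rank one.\<close>

lemma block_plus_tensor_sq_eq_0:
  assumes "x \<in> M" and eq: "block a b x + r *\<^sub>R tensor_sq \<alpha> = 0"
  shows "a = 0" "b = 0"
proof -
  note nz = in_M[OF assms(1)]
  have c: "(block a b x + r *\<^sub>R tensor_sq \<alpha>) $ i $ j = 0" for i j
    by (simp add: eq)
  have "a * g x $ 1 $ 1 = - (r * (\<alpha> $ 1 * \<alpha> $ 1))"
    "a * g x $ 2 $ 2 = - (r * (\<alpha> $ 2 * \<alpha> $ 2))"
    "r * (\<alpha> $ 1 * \<alpha> $ 2) = 0"
    using c[of 1 1] c[of 2 2] c[of 1 2] by (simp_all add: block_def tensor_sq_def metric)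
  \<comment> \<open>The off-diagonal equation makes \<open>r\<close>, \<open>\<alpha> $ 1\<close> or
    \<open>\<alpha> $ 2\<close> vanish, and in each case one of the two diagonal entries is
    zero.\<close>
  then have "(a * g x $ 1 $ 1) * (a * g x $ 2 $ 2) = 0"
    by auto
  then show "a = 0" using nz by (simp add: metric)
  have "b * g x $ 3 $ 3 = - (r * (\<alpha> $ 3 * \<alpha> $ 3))"
    "b * g x $ 4 $ 4 = - (r * (\<alpha> $ 4 * \<alpha> $ 4))"
    "r * (\<alpha> $ 3 * \<alpha> $ 4) = 0"
    using c[of 3 3] c[of 4 4] c[of 3 4] by (simp_all add: block_def tensor_sq_def metric)
  then have "(b * g x $ 3 $ 3) * (b * g x $ 4 $ 4) = 0"
    by auto
  then show "b = 0" using nz by (simp add: metric)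
qed

section \<open>The resulting differential equations\<close>

lemma deriv_eq_0:
  assumes "\<And>s. s \<in> I \<Longrightarrow> h s = 0" "t \<in> I" "(h has_real_derivative D) (at t)"
  shows "D = 0"
proof -
  have "((\<lambda>_. 0) has_real_derivative D) (at t)"
    using assms open_I by (auto intro: has_field_derivative_transform_within_open)
  then show ?thesis by (rule DERIV_unique) simp
qed

text \<open>The parameter \<open>c\<close> serves two structures: it is -1 for Ricci solitons and
  \<open>c\<^sub>2\<close> for generalized ones.\<close>

lemma no_ricci_solution:
  assumes t: "t \<in> I"
    and tz: "\<And>t. t \<in> I \<Longrightarrow> - F' t = - 2 * c * ric_tz t + 2 * l"
    and sph: "\<And>t. t \<in> I \<Longrightarrow> - 2 * F t / t = - 2 * c * ric_sph t + 2 * l"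
  shows False
proof -
  \<comment> \<open>This is the sphere equation multiplied by -s^2/2, which clears denominators
    before differentiating.\<close>
  have *: "s * F s - c * (F s + 1 + s * F' s) + l * s\<^sup>2 = 0" if "s \<in> I" for s
    using sph[OF that] pos[OF that] by (simp add: ric_sph_def field_simps power2_eq_square)
  have "F t + t * F' t - c * (2 * F' t + t * F'' t) + 2 * l * t = 0"
    by (rule deriv_eq_0[OF * t])
      (auto intro!: derivative_eq_intros F_deriv F'_deriv t simp: algebra_simps)
  \<comment> \<open>The (t, z) equation times -t agrees with the differentiated sphere equation
    except for the term \<open>F t\<close>.\<close>
  moreover have "t * F' t - c * (t * F'' t + 2 * F' t) + 2 * l * t = 0"
    using tz[OF t] pos[OF t] by (simp add: ric_tz_def field_simps)
  ultimately have "F t = 0" by (simp add: algebra_simps)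
  with F_nz[OF t] show False by simp
qed

text \<open>Both equations contain the same scalar curvature, so their difference is of first order
  and expresses F' and F'' through F. The sphere equation then becomes algebraic in F.\<close>

lemma no_yamabe_solution:
  assumes t: "t \<in> I"
    and tz: "\<And>t. t \<in> I \<Longrightarrow> - F' t / 2 + (l + 2 * (ric_tz t + ric_sph t)) = 0"
    and sph: "\<And>t. t \<in> I \<Longrightarrow> - F t / t + (l + 2 * (ric_tz t + ric_sph t)) = 0"
  shows False
proof -
  have 1: "s * F' s - 2 * F s = 0" if s: "s \<in> I" for s
  proof -
    have "- F' s / 2 = - F s / s"
      using tz[OF s] sph[OF s] by linarith
    with pos[OF s] show ?thesis by (simp add: field_simps)
  qed
  have 2: "s * F'' s - F' s = 0" if "s \<in> I" for s
    by (rule deriv_eq_0[OF 1 that])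
      (auto intro!: derivative_eq_intros F_deriv F'_deriv that simp: algebra_simps)
  have 3: "- (s * F s) + l * s\<^sup>2 + 12 * F s + 2 = 0" if s: "s \<in> I" for s
  proof -
    have "F' s = 2 * F s / s" "F'' s = F' s / s"
      using 1[OF s] 2[OF s] pos[OF s] by (simp_all add: field_simps)
    with sph[OF s] pos[OF s]
    have "s * 2 + l * (s * (s * s)) + s * (F s * 12) = s * (s * F s)"
      by (simp add: ric_tz_def ric_sph_def field_simps power2_eq_square)
    then have "s * (- (s * F s) + l * s\<^sup>2 + 12 * F s + 2) = 0"
      by algebra
    with pos[OF s] show ?thesis by simp
  qed
  have 4: "- (F s + s * F' s) + 2 * l * s + 12 * F' s = 0" if "s \<in> I" for s
    by (rule deriv_eq_0[OF 3 that])
      (auto intro!: derivative_eq_intros F_deriv F'_deriv that simp: algebra_simps)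
  \<comment> \<open>Twice \<open>3\<close> minus s times \<open>4\<close>, with s F' = 2 F inserted,
    cancels both the \<open>l\<close> terms and the multiples of 12 F.\<close>
  have 5: "s * F s + 4 = 0" if s: "s \<in> I" for s
    using 1[OF s] 3[OF s] arg_cong[OF 4[OF s], of "\<lambda>a. s * a"] by algebra
  have "F t + t * F' t = 0"
    by (rule deriv_eq_0[OF 5 t]) (auto intro!: derivative_eq_intros F_deriv t)
  \<comment> \<open>Inserting t F' = 2 F leaves 3 F = 0.\<close>
  with 1[OF t] F_nz[OF t] show False by simp
qed

end

section \<open>Reduction of the soliton structures to the differential equations\<close>

lemma ibh_chart_exists:
  fixes \<xi> :: "real \<Rightarrow> real"
  assumes "open I" and "I \<subseteq> {0<..}" and "smooth_on I \<xi>" and "\<forall>t\<in>I. t \<noteq> 2 * \<xi> t"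
  obtains F F' F'' where "ibh_chart \<xi> F F' F'' I"
proof -
  obtain \<xi>' \<xi>'' where d: "\<And>t. t \<in> I \<Longrightarrow> (\<xi> has_real_derivative \<xi>' t) (at t)"
      "\<And>t. t \<in> I \<Longrightarrow> (\<xi>' has_real_derivative \<xi>'' t) (at t)"
    using smooth_on_imp_two_derivatives assms(1,3) by blast
  have nz: "t \<noteq> 0" if "t \<in> I" for t
    using assms(2) that by auto
  have "ibh_chart \<xi> (\<lambda>t. 2 * \<xi> t / t - 1) (\<lambda>t. 2 * \<xi>' t / t - 2 * \<xi> t / t\<^sup>2)
    (\<lambda>t. 2 * \<xi>'' t / t - 4 * \<xi>' t / t\<^sup>2 + 4 * \<xi> t / t ^ 3) I"
  proof
    fix t assume t: "t \<in> I"
    show "0 < t" "2 * \<xi> t / t - 1 \<noteq> 0"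
      using assms(2,4) t nz[OF t] by (auto simp: field_simps)
    show "((\<lambda>t. 2 * \<xi> t / t - 1) has_real_derivative 2 * \<xi>' t / t - 2 * \<xi> t / t\<^sup>2) (at t)"
      using nz[OF t]
      by (auto intro!: derivative_eq_intros d t simp: field_simps power2_eq_square)
    show "((\<lambda>t. 2 * \<xi>' t / t - 2 * \<xi> t / t\<^sup>2) has_real_derivative
        2 * \<xi>'' t / t - 4 * \<xi>' t / t\<^sup>2 + 4 * \<xi> t / t ^ 3) (at t)"
      using nz[OF t]
      by (auto intro!: derivative_eq_intros d t simp: field_simps power2_eq_square power3_eq_cube)
  qed (use assms(1) in simp_all)
  then show thesis by (rule that)
qed

theorem proposition5p1:
  fixes \<xi> :: "real \<Rightarrow> real" and I :: "real set"
  assumes "open I" and "is_interval I" and "I \<noteq> {}" and "I \<subseteq> {0<..}"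
    and "smooth_on I \<xi>"
    and "\<forall>t\<in>I. t \<noteq> 2 * \<xi> t"
  shows "\<not> killing (ibh_domain I) (ibh_metric \<xi>) (ibh_field \<xi>)
    \<and> \<not> ricci_soliton (ibh_domain I) (ibh_metric \<xi>) (ibh_field \<xi>)
    \<and> \<not> yamabe_soliton (ibh_domain I) (ibh_metric \<xi>) (ibh_field \<xi>)
    \<and> \<not> gradient_ricci_soliton (ibh_domain I) (ibh_metric \<xi>) (ibh_field \<xi>)
    \<and> \<not> generalized_ricci_soliton (ibh_domain I) (ibh_metric \<xi>) (ibh_field \<xi>)
    \<and> \<not> eta_ricci_soliton (ibh_domain I) (ibh_metric \<xi>) (ibh_field \<xi>)
    \<and> \<not> eta_yamabe_soliton (ibh_domain I) (ibh_metric \<xi>) (ibh_field \<xi>)"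
proof -
  obtain F F' F'' where "ibh_chart \<xi> F F' F'' I"
    using ibh_chart_exists assms by blast
  then interpret ibh_chart \<xi> F F' F'' I .
  obtain t where t: "t \<in> I"
    using \<open>I \<noteq> {}\<close> by blast
  have killing: "\<not> killing M g X"
  proof
    assume "killing M g X"
    moreover obtain x where x: "x \<in> M" "x $ 1 = t"
      using point_in_M[OF t] .
    ultimately have "block (- F' t) (- 2 * F t / t) x + 0 *\<^sub>R tensor_sq 0 = 0"
      using lie_derivative_ibh[OF x(1)] by (simp add: killing_def)
    \<comment> \<open>The sphere factor -2 F / t vanishes nowhere, so \<open>X\<close> is not
      Killing.\<close>
    from block_plus_tensor_sq_eq_0(2)[OF x(1) this] show False
      using pos[OF t] F_nz[OF t] by simp
  qed
  \<comment> \<open>Keeping an arbitrary rank-one term treats the plain soliton, as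
    \<open>r = 0\<close>, together with the \<open>\<eta>\<close>-soliton. The same is done for
    \<open>yamabe\<close>.\<close>
  have ricci: False
    if eq: "\<And>x. x \<in> M \<Longrightarrow> (1/2) *\<^sub>R lie_derivative X g x + S_tensor g x - l *\<^sub>R g x
      + r *\<^sub>R tensor_sq (\<eta> x) = 0" for l r \<eta>
  proof -
    have *: "- F' s / 2 - ric_tz s - l = 0 \<and> - F s / s - ric_sph s - l = 0" if s: "s \<in> I" for s
    proof -
      obtain x where x: "x \<in> M" "x $ 1 = s"
        using point_in_M[OF s] .
      then have "block (- F' s / 2 - ric_tz s - l) (- F s / s - ric_sph s - l) x
          + r *\<^sub>R tensor_sq (\<eta> x) = 0"
        using eq[OF x(1)]
        by (simp add: lie_derivative_ibh S_tensor_ibh metric_block[of x] block_simps)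
      from block_plus_tensor_sq_eq_0[OF x(1) this] show ?thesis ..
    qed
    \<comment> \<open>Doubling gives the form required by \<open>no_ricci_solution\<close>, with c =
      -1.\<close>
    have "- F' s = - 2 * (- 1) * ric_tz s + 2 * l \<and>
        - 2 * F s / s = - 2 * (- 1) * ric_sph s + 2 * l" if "s \<in> I" for s
      using *[OF that] by (elim conjE, intro conjI; linarith)
    then show False
      by (intro no_ricci_solution[OF t, of "-1" l]) blast+
  qed
  have yamabe: False
    if eq: "\<And>x. x \<in> M \<Longrightarrow> (1/2) *\<^sub>R lie_derivative X g x + (l - scalar_curv g x) *\<^sub>R g x
      + r *\<^sub>R tensor_sq (\<eta> x) = 0" for l r \<eta>
  proof -
    have "- F' s / 2 + (l + 2 * (ric_tz s + ric_sph s)) = 0 \<and>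
        - F s / s + (l + 2 * (ric_tz s + ric_sph s)) = 0" if s: "s \<in> I" for s
    proof -
      obtain x where x: "x \<in> M" "x $ 1 = s"
        using point_in_M[OF s] .
      then have "block (- F' s / 2 + (l + 2 * (ric_tz s + ric_sph s)))
          (- F s / s + (l + 2 * (ric_tz s + ric_sph s))) x + r *\<^sub>R tensor_sq (\<eta> x) = 0"
        using eq[OF x(1)]
        by (simp add: lie_derivative_ibh scalar_curv_ibh metric_block[of x] block_simps
            algebra_simps)
      from block_plus_tensor_sq_eq_0[OF x(1) this] show ?thesis ..
    qed
    then show False
      by (intro no_yamabe_solution[OF t, of l]) blast+
  qed
  have generalized: "\<not> generalized_ricci_soliton M g X"
  proof
    assume "generalized_ricci_soliton M g X"
    then obtain c\<^sub>1 c\<^sub>2 l where eq: "\<And>x. x \<in> M \<Longrightarrow> lie_derivative X g x =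
        (- 2 * c\<^sub>1) *\<^sub>R tensor_sq (flat g X x) + (2 * c\<^sub>2) *\<^sub>R S_tensor g x + (2 * l) *\<^sub>R g x"
      unfolding generalized_ricci_soliton_def by blast
    have "- F' s = - 2 * c\<^sub>2 * ric_tz s + 2 * l \<and> - 2 * F s / s = - 2 * c\<^sub>2 * ric_sph s + 2 * l"
      if s: "s \<in> I" for s
    proof -
      obtain x where x: "x \<in> M" "x $ 1 = s"
        using point_in_M[OF s] .
      have "block (- F' s - (- 2 * c\<^sub>2 * ric_tz s + 2 * l))
          (- 2 * F s / s - (- 2 * c\<^sub>2 * ric_sph s + 2 * l)) x
          = lie_derivative X g x - ((2 * c\<^sub>2) *\<^sub>R S_tensor g x + (2 * l) *\<^sub>R g x)"
        using x by (simp add: lie_derivative_ibh S_tensor_ibh metric_block[of x] block_simps)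
      \<comment> \<open>With all terms on one side, the square of the dual form of \<open>X\<close>
        is the rank-one term, with coefficient \<open>2 * c\<^sub>1\<close>, so it cannot affect the
        block factors either.\<close>
      also have "\<dots> + (2 * c\<^sub>1) *\<^sub>R tensor_sq (flat g X x) = 0"
        using eq[OF x(1)] by simp
      finally show ?thesis
        using block_plus_tensor_sq_eq_0[OF x(1)] by fastforce
    qed
    then show False
      by (intro no_ricci_solution[OF t, of c\<^sub>2 l]) blast+
  qed
  have "\<not> ricci_soliton M g X"
    using ricci[where r = 0] by (auto simp: ricci_soliton_def)
  moreover have "\<not> yamabe_soliton M g X"
    using yamabe[where r = 0] by (auto simp: yamabe_soliton_def)
  moreover have "\<not> eta_ricci_soliton M g X"
    using ricci unfolding eta_ricci_soliton_def by blast
  moreover have "\<not> eta_yamabe_soliton M g X"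
    using yamabe unfolding eta_yamabe_soliton_def by blast
  ultimately show ?thesis
    using killing generalized by (simp add: gradient_ricci_soliton_def)
qed

end
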